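(* Let $\mathcal{I} = ((\mathcal{F}_i)_{i=1}^n,\pi)$ be an instance of the hiring problem, let $\mathrm{OPTOn}$ be an optimal (expected-value-maximizing) stopping rule for $\mathcal{I}$, and let $\mathrm{OPTOnIIF}$ be an optimal IIF stopping rule for $\mathcal{I}$. Then \[ \mathbb{E}[\mathrm{OPTOnIIF}] \ge \tfrac12\,\mathbb{E}[\mathrm{OPTOn}]. \] Moreover the inequality is tight: for every $c>1/2$ there is an instance for which $\mathbb{E}[\mathrm{OPTOnIIF}] < c\,\mathbb{E}[\mathrm{OPTOn}]$.
   Context: Hiring problem: $n$ candidates; candidate $i$ has a nonnegative random value $X_i\sim\mathcal{F}_i$, the $X_i$ independent, each $\mathcal{F}_i$ discrete; $f_i(x)=\Pr[X_i=x]$, $\mathcal{S}=\bigcup_i\{x:f_i(x)>0\}$. An instance with arrival ordering is $((\mathcal{F}_i)_{i=1}^n,\pi)$ with $\pi$ a permutation of $[n]$: at step $t$ candidate $\pi(t)$ arrives, $X_{\pi(t)}$ is revealed, and the decision maker either hires $\pi(t)$ (and stops) or rejects it irrevocably. A stopping rule is a possibly randomized procedure knowing $n$, the $\mathcal{F}_i$, $\pi$, deciding at step $t$ using only $X_{\pi(1)},\dots,X_{\pi(t)}$ (and own randomness), hiring at most one candidate. An algorithm's name also denotes the value of the hired candidate ($0$ if none). A stopping rule is IIF with probability function $p:\mathcal{S}\to[0,1]$ if $\Pr[\mathrm{ALG}\text{ hires } i\mid X_i=x]=p(x)$ for all $i\in[n]$, $x\in\mathcal{S}$; IIF means IIF with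 some such $p$. *)

theory Defs
  imports "HOL-Probability.Probability"
begin

definition hiring_instance :: "nat \<Rightarrow> (nat \<Rightarrow> real pmf) \<Rightarrow> (nat \<Rightarrow> nat) \<Rightarrow> bool" where
  "hiring_instance n F \<pi> \<longleftrightarrow>
     \<pi> permutes {1..n} \<and> (\<forall>i\<in>{1..n}. set_pmf (F i) \<subseteq> {0..})"

definition value_set :: "nat \<Rightarrow> (nat \<Rightarrow> real pmf) \<Rightarrow> real set" where
  "value_set n F = (\<Union>i\<in>{1..n}. {x. pmf (F i) x > 0})"

text \<open>
  A randomized stopping rule assigns to the list of the values revealed so far, in order of
  arrival and including the current one, the law of the decision on the current candidate, where
  \<open>True\<close> means to hire. The rule is consulted only while nobody has been hired, so its own past
  decisions carry no further information. The rule may depend on the (known) instance, since it is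
  always chosen for a fixed instance.
\<close>

type_synonym stopping_rule = "real list \<Rightarrow> bool pmf"

fun run_rule :: "stopping_rule \<Rightarrow> (nat \<Rightarrow> real) \<Rightarrow> real list \<Rightarrow> nat list \<Rightarrow> nat option pmf" where
  "run_rule \<sigma> X seen [] = return_pmf None"
| "run_rule \<sigma> X seen (i # is) =
     bind_pmf (\<sigma> (seen @ [X i]))
       (\<lambda>hire. if hire then return_pmf (Some i) else run_rule \<sigma> X (seen @ [X i]) is)"

text \<open>Joint law of the value vector, with independent entries, and of the hired candidate, if any.\<close>

definition outcome ::
  "nat \<Rightarrow> (nat \<Rightarrow> real pmf) \<Rightarrow> (nat \<Rightarrow> nat) \<Rightarrow> stopping_rule \<Rightarrow> ((nat \<Rightarrow> real) \<times> nat option) pmf" where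
  "outcome n F \<pi> \<sigma> =
     bind_pmf (Pi_pmf {1..n} 0 F)
       (\<lambda>X. map_pmf (\<lambda>h. (X, h)) (run_rule \<sigma> X [] (map \<pi> [1..<Suc n])))"

fun hired_value :: "(nat \<Rightarrow> real) \<times> nat option \<Rightarrow> real" where
  "hired_value (X, None) = 0"
| "hired_value (X, Some i) = X i"

text \<open>Values are nonnegative but need not have finite mean, so expectations are extended reals.\<close>

definition expected_value ::
  "nat \<Rightarrow> (nat \<Rightarrow> real pmf) \<Rightarrow> (nat \<Rightarrow> nat) \<Rightarrow> stopping_rule \<Rightarrow> ennreal" where
  "expected_value n F \<pi> \<sigma> =
     (\<integral>\<^sup>+ \<omega>. ennreal (hired_value \<omega>) \<partial>measure_pmf (outcome n F \<pi> \<sigma>))"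

text \<open>The conditional probability is required to be \<open>p x\<close> whenever it is defined.\<close>

definition IIF_with ::
  "nat \<Rightarrow> (nat \<Rightarrow> real pmf) \<Rightarrow> (nat \<Rightarrow> nat) \<Rightarrow> stopping_rule \<Rightarrow> (real \<Rightarrow> real) \<Rightarrow> bool" where
  "IIF_with n F \<pi> \<sigma> p \<longleftrightarrow>
     (\<forall>x\<in>value_set n F. 0 \<le> p x \<and> p x \<le> 1) \<and>
     (\<forall>i\<in>{1..n}. \<forall>x\<in>value_set n F. pmf (F i) x > 0 \<longrightarrow>
        cond_prob (measure_pmf (outcome n F \<pi> \<sigma>))
          (\<lambda>\<omega>. snd \<omega> = Some i) (\<lambda>\<omega>. fst \<omega> i = x) = p x)"

definition IIF :: "nat \<Rightarrow> (nat \<Rightarrow> real pmf) \<Rightarrow> (nat \<Rightarrow> nat) \<Rightarrow> stopping_rule \<Rightarrow> bool" where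
  "IIF n F \<pi> \<sigma> \<longleftrightarrow> (\<exists>p. IIF_with n F \<pi> \<sigma> p)"

definition optimal_rule ::
  "nat \<Rightarrow> (nat \<Rightarrow> real pmf) \<Rightarrow> (nat \<Rightarrow> nat) \<Rightarrow> stopping_rule \<Rightarrow> bool" where
  "optimal_rule n F \<pi> \<sigma> \<longleftrightarrow> (\<forall>\<tau>. expected_value n F \<pi> \<tau> \<le> expected_value n F \<pi> \<sigma>)"

definition optimal_IIF_rule ::
  "nat \<Rightarrow> (nat \<Rightarrow> real pmf) \<Rightarrow> (nat \<Rightarrow> nat) \<Rightarrow> stopping_rule \<Rightarrow> bool" where
  "optimal_IIF_rule n F \<pi> \<sigma> \<longleftrightarrow>
     IIF n F \<pi> \<sigma> \<and> (\<forall>\<tau>. IIF n F \<pi> \<tau> \<longrightarrow> expected_value n F \<pi> \<tau> \<le> expected_value n F \<pi> \<sigma>)"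

end

(*
  Let m(x) be the probability that a given rule hires somebody of value x, and let
  f(x) be the sum of the probabilities Pr[X_i = x] over all candidates i. Hiring every candidate
  with conditional probability q(x) = m(x) / f(x) would preserve the expected value, and the total
  hiring probability is still at most 1. Halving q to r = q / 2 makes it attainable online: by the
  time a candidate arrives, the position is filled with probability at most 1/2, independently of
  the value x of the candidate, so one can hire with probability r(x) / Pr[position still open].

  For tightness, let X_1 = 1, and let X_2 be 1 with probability eps and 0 otherwise. Hiring the
  first candidate yields 1, while an IIF rule has p(1) <= 1 - p(1), hence value at most
  (1 + eps) / 2.
*)
theory Submission
  imports Defs
begin

section \<open>Hire masses and the linear functionals they determine\<close>

text \<open>A joint rather than a conditional probability: masses need no division, add up over
  candidates, and determine both the expected value and the IIF property of a rule.\<close>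

definition hire_mass ::
  "nat \<Rightarrow> (nat \<Rightarrow> real pmf) \<Rightarrow> (nat \<Rightarrow> nat) \<Rightarrow> stopping_rule \<Rightarrow> nat \<Rightarrow> real \<Rightarrow> real" where
  "hire_mass n F \<pi> \<sigma> i x =
     measure_pmf.prob (outcome n F \<pi> \<sigma>) {\<omega>. fst \<omega> i = x \<and> snd \<omega> = Some i}"

lemma hire_mass_nonneg [simp]: "0 \<le> hire_mass n F \<pi> \<sigma> i x"
  by (simp add: hire_mass_def)

lemma prob_outcome_component:
  assumes "i \<in> {1..n}"
  shows "measure_pmf.prob (outcome n F \<pi> \<sigma>) {\<omega>. fst \<omega> i = x} = pmf (F i) x"
proof -
  have "map_pmf fst (outcome n F \<pi> \<sigma>) = Pi_pmf {1..n} 0 F"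
    by (simp add: outcome_def map_bind_pmf map_pmf_comp bind_return_pmf')
  hence "map_pmf (\<lambda>X. X i) (map_pmf fst (outcome n F \<pi> \<sigma>)) = F i"
    using assms by (simp only: Pi_pmf_component finite_atLeastAtMost if_True)
  hence "map_pmf (\<lambda>\<omega>. fst \<omega> i) (outcome n F \<pi> \<sigma>) = F i"
    by (simp only: map_pmf_comp)
  hence "pmf (F i) x = pmf (map_pmf (\<lambda>\<omega>. fst \<omega> i) (outcome n F \<pi> \<sigma>)) x" by simp
  also have "\<dots> = measure_pmf.prob (outcome n F \<pi> \<sigma>) ((\<lambda>\<omega>. fst \<omega> i) -` {x})"
    by (simp add: pmf_map)
  also have "(\<lambda>\<omega>. fst \<omega> i) -` {x} = {\<omega>::(nat \<Rightarrow> real) \<times> nat option. fst \<omega> i = x}" by auto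
  finally show ?thesis by simp
qed

lemma hire_mass_le_pmf:
  assumes "i \<in> {1..n}"
  shows "hire_mass n F \<pi> \<sigma> i x \<le> pmf (F i) x"
  unfolding hire_mass_def prob_outcome_component[OF assms, of F \<pi> \<sigma>, symmetric]
  by (rule measure_pmf.finite_measure_mono) auto

lemma set_pmf_run_rule: "set_pmf (run_rule \<sigma> X seen js) \<subseteq> insert None (Some ` set js)"
  by (induction js arbitrary: seen) (force split: if_splits)+

text \<open>At most one candidate is hired, so the reward splits into a sum over candidates with at
  most one nonzero term. The weight \<open>\<phi>\<close> is kept general because two cases are
  needed: the value itself, giving the expected value, and the constant 1, giving the total hiring
  probability.\<close>

lemma nn_integral_hired:
  fixes \<phi> :: "real \<Rightarrow> ennreal"
  assumes "\<pi> permutes {1..n}"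
  shows "(\<integral>\<^sup>+ \<omega>. (case snd \<omega> of None \<Rightarrow> 0 | Some i \<Rightarrow> \<phi> (fst \<omega> i)) \<partial>measure_pmf (outcome n F \<pi> \<sigma>)) =
         (\<Sum>i=1..n. \<integral>\<^sup>+ x. \<phi> x * ennreal (hire_mass n F \<pi> \<sigma> i x) \<partial>count_space UNIV)"
proof -
  let ?O = "outcome n F \<pi> \<sigma>"
  have "set (map \<pi> [1..<Suc n]) = {1..n}"
    using permutes_image[OF assms] by (simp add: atLeastLessThanSuc_atLeastAtMost del: upt_Suc)
  hence supp: "snd \<omega> \<in> insert None (Some ` {1..n})" if "\<omega> \<in> set_pmf ?O" for \<omega>
    using that set_pmf_run_rule[of \<sigma> "fst \<omega>" "[]" "map \<pi> [1..<Suc n]"]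
    by (auto simp: outcome_def simp del: upt_Suc set_map)
  have "(\<integral>\<^sup>+ \<omega>. (case snd \<omega> of None \<Rightarrow> 0 | Some i \<Rightarrow> \<phi> (fst \<omega> i)) \<partial>measure_pmf ?O) =
        (\<integral>\<^sup>+ \<omega>. (\<Sum>i=1..n. if snd \<omega> = Some i then \<phi> (fst \<omega> i) else 0) \<partial>measure_pmf ?O)"
    by (intro nn_integral_cong_AE AE_pmfI) (auto dest!: supp)
  also have "\<dots> = (\<Sum>i=1..n. \<integral>\<^sup>+ \<omega>. (if snd \<omega> = Some i then \<phi> (fst \<omega> i) else 0) \<partial>measure_pmf ?O)"
    by (rule nn_integral_sum) auto
  also have "\<dots> = (\<Sum>i=1..n. \<integral>\<^sup>+ x. \<phi> x * ennreal (hire_mass n F \<pi> \<sigma> i x) \<partial>count_space UNIV)"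
  proof (rule sum.cong[OF refl])
    fix i
    \<comment> \<open>The summand depends only on the value of \<open>i\<close> and on whether
      \<open>i\<close> is hired. Pushing forward to this pair gives a sum over reals and Booleans in
      which only \<open>True\<close> contributes.\<close>
    let ?h = "\<lambda>\<omega>::(nat \<Rightarrow> real) \<times> nat option. (fst \<omega> i, snd \<omega> = Some i)"
    let ?f = "\<lambda>z::real \<times> bool. if snd z then \<phi> (fst z) else 0"
    have m: "pmf (map_pmf ?h ?O) (x, True) = hire_mass n F \<pi> \<sigma> i x" for x
      unfolding hire_mass_def pmf_map by (rule arg_cong[where f = "measure ?O"]) auto
    have "(\<integral>\<^sup>+ \<omega>. (if snd \<omega> = Some i then \<phi> (fst \<omega> i) else 0) \<partial>measure_pmf ?O) =
          (\<integral>\<^sup>+ z. ?f z \<partial>measure_pmf (map_pmf ?h ?O))"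
      unfolding nn_integral_map_pmf fst_conv snd_conv ..
    also have "\<dots> = (\<integral>\<^sup>+ z. ennreal (pmf (map_pmf ?h ?O) z) * ?f z \<partial>count_space UNIV)"
      by (rule nn_integral_measure_pmf)
    also have "\<dots> = (\<integral>\<^sup>+ x. \<integral>\<^sup>+ b. ennreal (pmf (map_pmf ?h ?O) (x, b)) * ?f (x, b)
                        \<partial>count_space UNIV \<partial>count_space UNIV)"
      by (subst nn_integral_fst_count_space[symmetric]) simp
    also have "\<dots> = (\<integral>\<^sup>+ x. \<phi> x * ennreal (hire_mass n F \<pi> \<sigma> i x) \<partial>count_space UNIV)"
      by (simp add: nn_integral_count_space_finite UNIV_bool m mult.commute)
    finally show "(\<integral>\<^sup>+ \<omega>. (if snd \<omega> = Some i then \<phi> (fst \<omega> i) else 0) \<partial>measure_pmf ?O) =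
      (\<integral>\<^sup>+ x. \<phi> x * ennreal (hire_mass n F \<pi> \<sigma> i x) \<partial>count_space UNIV)" .
  qed
  finally show ?thesis .
qed

lemma expected_value_eq_hire_mass:
  assumes "\<pi> permutes {1..n}"
  shows "expected_value n F \<pi> \<sigma> =
         (\<Sum>i=1..n. \<integral>\<^sup>+ x. ennreal x * ennreal (hire_mass n F \<pi> \<sigma> i x) \<partial>count_space UNIV)"
proof -
  have "ennreal (hired_value \<omega>) = (case snd \<omega> of None \<Rightarrow> 0 | Some i \<Rightarrow> ennreal (fst \<omega> i))" for \<omega>
    by (cases \<omega>; cases "snd \<omega>") auto
  thus ?thesis unfolding expected_value_def by (simp add: nn_integral_hired[OF assms])
qed

lemma sum_hire_mass_le_1:
  assumes "\<pi> permutes {1..n}"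
  shows "(\<Sum>i=1..n. \<integral>\<^sup>+ x. ennreal (hire_mass n F \<pi> \<sigma> i x) \<partial>count_space UNIV) \<le> 1"
proof -
  have "(\<Sum>i=1..n. \<integral>\<^sup>+ x. ennreal (hire_mass n F \<pi> \<sigma> i x) \<partial>count_space UNIV) =
    (\<integral>\<^sup>+ \<omega>. (case snd \<omega> of None \<Rightarrow> 0 | Some i \<Rightarrow> 1) \<partial>measure_pmf (outcome n F \<pi> \<sigma>))"
    using nn_integral_hired[OF assms, where \<phi> = "\<lambda>_. 1" and F = F and \<sigma> = \<sigma>] by simp
  also have "\<dots> \<le> (\<integral>\<^sup>+ \<omega>. 1 \<partial>measure_pmf (outcome n F \<pi> \<sigma>))"
    by (rule nn_integral_mono) (auto split: option.splits)
  also have "\<dots> = 1" by simp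
  finally show ?thesis .
qed

section \<open>Conditioning on the value vector, and IIF in terms of masses\<close>

text \<open>Integrating out the rule's own randomness for a fixed value vector leaves a point
  probability of \<open>run_rule\<close>, which can be computed by recursion on the
  arrivals.\<close>

lemma hire_mass_eq_expectation:
  "hire_mass n F \<pi> \<sigma> i x =
     measure_pmf.expectation (Pi_pmf {1..n} 0 F)
       (\<lambda>X. of_bool (X i = x) * pmf (run_rule \<sigma> X [] (map \<pi> [1..<Suc n])) (Some i))"
proof -
  let ?h = "\<lambda>\<omega>::(nat \<Rightarrow> real) \<times> nat option. (fst \<omega> i, snd \<omega>)"
  have "hire_mass n F \<pi> \<sigma> i x = pmf (map_pmf ?h (outcome n F \<pi> \<sigma>)) (x, Some i)"
    unfolding hire_mass_def pmf_map by (rule arg_cong[where f = "measure _"]) auto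
  also have "map_pmf ?h (outcome n F \<pi> \<sigma>) =
     bind_pmf (Pi_pmf {1..n} 0 F)
       (\<lambda>X. map_pmf (Pair (X i)) (run_rule \<sigma> X [] (map \<pi> [1..<Suc n])))"
    by (simp add: outcome_def map_bind_pmf map_pmf_comp del: upt_Suc)
  also have "pmf \<dots> (x, Some i) = measure_pmf.expectation (Pi_pmf {1..n} 0 F)
     (\<lambda>X. pmf (map_pmf (Pair (X i)) (run_rule \<sigma> X [] (map \<pi> [1..<Suc n]))) (x, Some i))"
    by (rule pmf_bind)
  moreover have "pmf (map_pmf (Pair (X i)) q) (x, Some i) = of_bool (X i = x) * pmf q (Some i)"
    for X :: "nat \<Rightarrow> real" and q
  proof (cases "X i = x")
    case True
    have "inj (Pair x :: nat option \<Rightarrow> _)" by (auto intro: injI)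
    from pmf_map_inj'[OF this] True show ?thesis by auto
  next
    case False
    hence "(x, Some i) \<notin> set_pmf (map_pmf (Pair (X i)) q)" by auto
    hence "pmf (map_pmf (Pair (X i)) q) (x, Some i) = 0" by (simp only: set_pmf_iff not_not)
    with False show ?thesis by simp
  qed
  ultimately show ?thesis by (simp only:)
qed

lemma pmf_run_rule_Cons:
  "pmf (run_rule \<sigma> X seen (j # js)) (Some i) =
     pmf (\<sigma> (seen @ [X j])) True * of_bool (i = j) +
     (1 - pmf (\<sigma> (seen @ [X j])) True) * pmf (run_rule \<sigma> X (seen @ [X j]) js) (Some i)"
proof -
  have f: "pmf q False = 1 - pmf q True" for q :: "bool pmf"
    using sum_pmf_eq_1[of UNIV q, OF _ subset_UNIV] by (simp add: algebra_simps UNIV_bool)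
  show ?thesis
    by (subst run_rule.simps, subst pmf_bind, subst integral_measure_pmf[where A = "{True, False}"])
       (auto simp: f)
qed

text \<open>Multiplying the conditional probability by Pr[X_i = x] > 0 clears the denominator, so
  that IIF is checked on masses alone.\<close>

lemma IIF_with_hire_mass:
  "IIF_with n F \<pi> \<sigma> p \<longleftrightarrow>
     (\<forall>x\<in>value_set n F. 0 \<le> p x \<and> p x \<le> 1) \<and>
     (\<forall>i\<in>{1..n}. \<forall>x. pmf (F i) x > 0 \<longrightarrow> hire_mass n F \<pi> \<sigma> i x = pmf (F i) x * p x)"
proof -
  have "cond_prob (measure_pmf (outcome n F \<pi> \<sigma>)) (\<lambda>\<omega>. snd \<omega> = Some i) (\<lambda>\<omega>. fst \<omega> i = x) =
        hire_mass n F \<pi> \<sigma> i x / pmf (F i) x" if "i \<in> {1..n}" for i x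
    using prob_outcome_component[OF that]
    by (simp add: cond_prob_def hire_mass_def conj_commute)
  moreover have "x \<in> value_set n F" if "i \<in> {1..n}" "pmf (F i) x > 0" for i x
    using that by (auto simp: value_set_def)
  ultimately show ?thesis
    unfolding IIF_with_def by (auto simp: field_simps)
qed

section \<open>Memoryless rules\<close>

text \<open>A rule of the form \<open>\<lambda>l. bernoulli_pmf (h (length l) (last l))\<close> hires at step \<open>t\<close> with a
  probability depending only on \<open>t\<close> and on the current value.\<close>

lemma pmf_run_memoryless_rule:
  assumes h: "\<And>t y. t \<in> {1..n} \<Longrightarrow> 0 \<le> h t y \<and> h t y \<le> 1"
    and \<pi>: "inj_on \<pi> {1..n}" and "t \<le> n" "1 \<le> a" "a \<le> t" "length seen = a - 1"
  shows "pmf (run_rule (\<lambda>l. bernoulli_pmf (h (length l) (last l))) X seen (map \<pi> [a..<Suc n]))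
           (Some (\<pi> t)) = (\<Prod>s\<in>{a..<t}. 1 - h s (X (\<pi> s))) * h t (X (\<pi> t))"
  using \<open>a \<le> t\<close> \<open>1 \<le> a\<close> \<open>length seen = a - 1\<close>
\<comment> \<open>Downward induction on the next arrival \<open>a\<close>, starting from
  \<open>a = t\<close>. Since \<open>length seen = a - 1\<close>, the history including the current
  value has length \<open>a\<close>, so the rule consults \<open>h a\<close>.\<close>
proof (induction a arbitrary: seen rule: inc_induct)
  case base
  let ?\<sigma> = "\<lambda>l. bernoulli_pmf (h (length l) (last l))"
  \<comment> \<open>Each candidate arrives once, so once rejected at step \<open>t\<close> the
    candidate cannot be hired later.\<close>
  have "\<pi> t \<notin> set (map \<pi> [Suc t..<Suc n])"
    using base \<open>t \<le> n\<close> by (auto dest!: inj_onD[OF \<pi>] simp del: upt_Suc)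
  hence "Some (\<pi> t) \<notin> set_pmf (run_rule ?\<sigma> X (seen @ [X (\<pi> t)]) (map \<pi> [Suc t..<Suc n]))"
    using set_pmf_run_rule[of ?\<sigma> X "seen @ [X (\<pi> t)]" "map \<pi> [Suc t..<Suc n]"] by blast
  hence "pmf (run_rule ?\<sigma> X (seen @ [X (\<pi> t)]) (map \<pi> [Suc t..<Suc n])) (Some (\<pi> t)) = 0"
    by (simp add: set_pmf_iff)
  moreover have "[t..<Suc n] = t # [Suc t..<Suc n]" using \<open>t \<le> n\<close> by (simp add: upt_conv_Cons)
  ultimately show ?case
    using h[of t] base \<open>t \<le> n\<close> by (simp add: pmf_run_rule_Cons del: upt_Suc run_rule.simps)
next
  case (step a)
  have "[a..<Suc n] = a # [Suc a..<Suc n]" using \<open>t \<le> n\<close> step by (simp add: upt_conv_Cons)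
  moreover have "\<pi> t \<noteq> \<pi> a" using step \<open>t \<le> n\<close> by (auto dest!: inj_onD[OF \<pi>])
  moreover have "{a..<t} = insert a {Suc a..<t}" using step by auto
  ultimately show ?case
    using h[of a] step \<open>t \<le> n\<close> by (simp add: pmf_run_rule_Cons del: upt_Suc run_rule.simps)
qed

text \<open>The decisions of a memoryless rule at different steps depend on different, independent
  values, so the probability of rejecting everybody before \<open>t\<close> factorizes and is
  independent of the value arriving at \<open>t\<close>.\<close>

lemma hire_mass_memoryless_rule:
  assumes h: "\<And>t y. t \<in> {1..n} \<Longrightarrow> 0 \<le> h t y \<and> h t y \<le> 1"
    and \<pi>: "\<pi> permutes {1..n}" and t: "t \<in> {1..n}"
  shows "hire_mass n F \<pi> (\<lambda>l. bernoulli_pmf (h (length l) (last l))) (\<pi> t) x =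
         pmf (F (\<pi> t)) x * h t x * (\<Prod>s\<in>{1..<t}. 1 - measure_pmf.expectation (F (\<pi> s)) (h s))"
proof -
  let ?I = "{1..n}"
  \<comment> \<open>One factor per step turns the integrand into a product over all coordinates:
    rejection before \<open>t\<close>, value \<open>x\<close> and a hire at \<open>t\<close>, and
    the neutral factor 1 afterwards.\<close>
  define K :: "nat \<Rightarrow> real \<Rightarrow> real" where
    "K s y = (if s < t then 1 - h s y else if s = t then of_bool (y = x) * h t y else 1)" for s y
  have K01: "0 \<le> K s y \<and> K s y \<le> 1" if "s \<in> ?I" for s y
    using h[OF that, of y] h[OF t, of y] by (auto simp: K_def)
  have h_int: "integrable (measure_pmf q) (h s)" if "s \<in> ?I" for s q
    using h[OF that] by (intro measure_pmf.integrable_const_bound[where B = 1]) auto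
  have K_int: "integrable (measure_pmf q) (K s)" if "s \<in> ?I" for s q
    using K01[OF that] by (intro measure_pmf.integrable_const_bound[where B = 1]) auto
  have inv: "inv \<pi> j \<in> ?I" "\<pi> (inv \<pi> j) = j" if "j \<in> ?I" for j
    using that permutes_inverses[OF \<pi>] permutes_in_image[OF permutes_inv[OF \<pi>]] by blast+
  \<comment> \<open>The factors \<open>K\<close> are indexed by arrival time, but
    \<open>Pi_pmf\<close> by candidate; the permutation translates between the two.\<close>
  have reindex: "(\<Prod>j\<in>?I. g (inv \<pi> j) j) = (\<Prod>s\<in>?I. g s (\<pi> s))" for g :: "nat \<Rightarrow> nat \<Rightarrow> real"
    by (subst prod.permute[OF \<pi>]) (simp add: o_def permutes_inverses[OF \<pi>])
  have split: "(\<Prod>s\<in>?I. g s) = (\<Prod>s\<in>{1..<t}. g s) * g t" if "\<And>s. s > t \<Longrightarrow> g s = 1"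
    for g :: "nat \<Rightarrow> real"
  proof -
    have "(\<Prod>s\<in>?I. g s) = (\<Prod>s\<in>{1..t}. g s)"
      using t that by (intro prod.mono_neutral_right) auto
    also have "{1..t} = insert t {1..<t}" using t by auto
    finally show ?thesis by simp
  qed
  have "hire_mass n F \<pi> (\<lambda>l. bernoulli_pmf (h (length l) (last l))) (\<pi> t) x =
     measure_pmf.expectation (Pi_pmf ?I 0 F)
       (\<lambda>X. of_bool (X (\<pi> t) = x) * ((\<Prod>s\<in>{1..<t}. 1 - h s (X (\<pi> s))) * h t (X (\<pi> t))))"
    unfolding hire_mass_eq_expectation
    by (subst pmf_run_memoryless_rule[OF h permutes_inj_on[OF \<pi>]]) (use t in auto)
  also have "\<dots> = measure_pmf.expectation (Pi_pmf ?I 0 F) (\<lambda>X. \<Prod>s\<in>?I. K s (X (\<pi> s)))"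
    by (subst split) (auto simp: K_def mult_ac)
  also have "\<dots> = measure_pmf.expectation (Pi_pmf ?I 0 F) (\<lambda>X. \<Prod>j\<in>?I. K (inv \<pi> j) (X j))"
    by (subst reindex[of "\<lambda>s j. K s (_ j)"]) simp
  also have "\<dots> = (\<Prod>j\<in>?I. measure_pmf.expectation (F j) (K (inv \<pi> j)))"
    using K01 K_int inv by (intro expectation_prod_Pi_pmf) auto
  also have "\<dots> = (\<Prod>s\<in>?I. measure_pmf.expectation (F (\<pi> s)) (K s))"
    by (rule reindex[of "\<lambda>s j. measure_pmf.expectation (F j) (K s)"])
  also have "\<dots> = (\<Prod>s\<in>{1..<t}. measure_pmf.expectation (F (\<pi> s)) (K s)) *
      measure_pmf.expectation (F (\<pi> t)) (K t)"
    by (rule split) (simp add: K_def[abs_def])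
  also have "measure_pmf.expectation (F (\<pi> t)) (K t) = pmf (F (\<pi> t)) x * h t x"
    by (subst integral_measure_pmf[where A = "{x}"]) (auto simp: K_def split: if_splits)
  also have "(\<Prod>s\<in>{1..<t}. measure_pmf.expectation (F (\<pi> s)) (K s)) =
      (\<Prod>s\<in>{1..<t}. 1 - measure_pmf.expectation (F (\<pi> s)) (h s))"
    using t by (intro prod.cong refl) (simp add: K_def[abs_def] Bochner_Integration.integral_diff h_int)
  finally show ?thesis by (simp add: mult_ac)
qed

section \<open>An IIF rule with half the value\<close>

text \<open>Here \<open>c t\<close> is the probability that the position is still open at step
  \<open>t\<close>, so hiring with probability \<open>r y / c t\<close> produces the unconditional
  probability \<open>r y\<close>. The quotient is a probability because r \<le> 1/2 \<le>
  \<open>c t\<close>: the first bound is on \<open>r\<close> pointwise, the second comes from the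
  bound on the total.\<close>

lemma exists_rule_with_hire_probability:
  assumes \<pi>: "\<pi> permutes {1..n}" and r: "\<And>x. 0 \<le> r x \<and> r x \<le> 1/2"
    and total: "(\<Sum>i=1..n. measure_pmf.expectation (F i) r) \<le> 1/2"
  shows "\<exists>\<tau>. \<forall>i\<in>{1..n}. \<forall>x. hire_mass n F \<pi> \<tau> i x = pmf (F i) x * r x"
proof -
  define e where "e s = measure_pmf.expectation (F (\<pi> s)) r" for s
  define c where "c t = 1 - (\<Sum>s\<in>{1..<t}. e s)" for t
  define h where "h t y = r y / c t" for t y
  have e0: "0 \<le> e s" for s unfolding e_def using r by (intro integral_nonneg_AE) auto
  have sum_e: "(\<Sum>s=1..n. e s) \<le> 1/2"
    using total sum.permute[OF \<pi>, of "\<lambda>i. measure_pmf.expectation (F i) r"]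
    by (simp add: e_def o_def)
  have c: "1/2 \<le> c t" if "t \<in> {1..n}" for t
  proof -
    have "(\<Sum>s\<in>{1..<t}. e s) \<le> (\<Sum>s=1..n. e s)" using that e0 by (intro sum_mono2) auto
    thus ?thesis using sum_e by (simp add: c_def)
  qed
  have h: "0 \<le> h t y \<and> h t y \<le> 1" if "t \<in> {1..n}" for t y
    using c[OF that] r[of y] by (simp add: h_def divide_simps)
  \<comment> \<open>The product telescopes: \<open>c t\<close> * (1 - \<open>e t / c t\<close>) =
    \<open>c t - e t\<close> = \<open>c (Suc t)\<close>. This identifies the additive definition of
    \<open>c\<close> with the probability of having rejected everybody so far.\<close>
  have prod: "(\<Prod>s\<in>{1..<t}. 1 - measure_pmf.expectation (F (\<pi> s)) (h s)) = c t" if "t \<le> n" "1 \<le> t" for t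
    using \<open>1 \<le> t\<close> \<open>t \<le> n\<close>
  proof (induction t rule: dec_induct)
    case base
    show ?case by (simp add: c_def)
  next
    case (step t)
    have "measure_pmf.expectation (F (\<pi> t)) (h t) = e t / c t"
      unfolding h_def e_def by simp
    moreover have "c (Suc t) = c t - e t" using step by (simp add: c_def)
    moreover have "c t \<noteq> 0" using c[of t] step by force
    ultimately show ?case using step by (simp add: field_simps)
  qed
  have "hire_mass n F \<pi> (\<lambda>l. bernoulli_pmf (h (length l) (last l))) i x = pmf (F i) x * r x"
    if "i \<in> {1..n}" for i x
  proof -
    have "i \<in> \<pi> ` {1..n}" using that by (simp only: permutes_image[OF \<pi>])
    then obtain t where t: "t \<in> {1..n}" "i = \<pi> t" by (elim imageE)
    have "hire_mass n F \<pi> (\<lambda>l. bernoulli_pmf (h (length l) (last l))) (\<pi> t) x =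
        pmf (F (\<pi> t)) x * h t x * (\<Prod>s\<in>{1..<t}. 1 - measure_pmf.expectation (F (\<pi> s)) (h s))"
      by (rule hire_mass_memoryless_rule[where h = h, OF h \<pi> t(1)])
    also have "\<dots> = pmf (F (\<pi> t)) x * h t x * c t"
      using t(1) by (subst prod) auto
    also have "\<dots> = pmf (F (\<pi> t)) x * r x"
      using c[OF t(1)] by (simp add: h_def)
    finally show ?thesis by (simp only: t(2))
  qed
  thus ?thesis by blast
qed

lemma exists_IIF_rule_half:
  assumes \<pi>: "\<pi> permutes {1..n}"
  shows "\<exists>\<tau>. IIF n F \<pi> \<tau> \<and> expected_value n F \<pi> \<tau> = 1/2 * expected_value n F \<pi> \<sigma>"
proof -
  let ?I = "{1..n}"
  define m where "m x = (\<Sum>i\<in>?I. hire_mass n F \<pi> \<sigma> i x)" for x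
  define f where "f x = (\<Sum>i\<in>?I. pmf (F i) x)" for x
  \<comment> \<open>If \<open>f x = 0\<close> then division by zero yields \<open>r x = 0\<close>;
    this is consistent, since 0 \<le> m \<le> f forces \<open>m x = 0\<close> there.\<close>
  define r where "r x = 1/2 * (m x / f x)" for x
  have m0: "0 \<le> m x" for x unfolding m_def by (intro sum_nonneg) auto
  have mf: "m x \<le> f x" for x unfolding m_def f_def by (intro sum_mono hire_mass_le_pmf)
  have r: "0 \<le> r x \<and> r x \<le> 1/2" for x
    using m0[of x] mf[of x] by (auto simp: r_def divide_simps)
  have fr: "(\<Sum>i\<in>?I. pmf (F i) x * r x) = 1/2 * m x" for x
  proof -
    have "(\<Sum>i\<in>?I. pmf (F i) x * r x) = f x * r x" by (simp add: f_def sum_distrib_right)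
    thus ?thesis using m0[of x] mf[of x] by (auto simp: r_def)
  qed
  have fr': "(\<Sum>i\<in>?I. ennreal (pmf (F i) x * r x)) = 1/2 * (\<Sum>i\<in>?I. ennreal (hire_mass n F \<pi> \<sigma> i x))" for x
  proof -
    have "(\<Sum>i\<in>?I. ennreal (pmf (F i) x * r x)) = ennreal (1/2 * m x)"
      unfolding fr[symmetric] using r by (intro sum_ennreal) simp
    also have "\<dots> = 1/2 * ennreal (m x)"
      using m0[of x] by (simp add: ennreal_mult ennreal_divide_numeral[symmetric] divide_ennreal_def mult.commute)
    also have "ennreal (m x) = (\<Sum>i\<in>?I. ennreal (hire_mass n F \<pi> \<sigma> i x))"
      unfolding m_def by (simp add: sum_ennreal)
    finally show ?thesis .
  qed
  \<comment> \<open>Redistributing mass among candidates of equal value does not change the integral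
    of a weight that depends only on the value. The constant weight 1 bounds the total hiring
    probability by 1/2; the identity weight halves the expected value.\<close>
  have weighted: "(\<Sum>i\<in>?I. \<integral>\<^sup>+ x. \<phi> x * ennreal (pmf (F i) x * r x) \<partial>count_space UNIV) =
      1/2 * (\<Sum>i\<in>?I. \<integral>\<^sup>+ x. \<phi> x * ennreal (hire_mass n F \<pi> \<sigma> i x) \<partial>count_space UNIV)" for \<phi> :: "real \<Rightarrow> ennreal"
  proof -
    have "(\<Sum>i\<in>?I. \<integral>\<^sup>+ x. \<phi> x * ennreal (pmf (F i) x * r x) \<partial>count_space UNIV) =
          (\<integral>\<^sup>+ x. \<phi> x * (\<Sum>i\<in>?I. ennreal (pmf (F i) x * r x)) \<partial>count_space UNIV)"
      by (simp add: nn_integral_sum sum_distrib_left)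
    also have "\<dots> = (\<integral>\<^sup>+ x. 1/2 * (\<phi> x * (\<Sum>i\<in>?I. ennreal (hire_mass n F \<pi> \<sigma> i x))) \<partial>count_space UNIV)"
      unfolding fr' by (simp only: mult_ac)
    also have "\<dots> = 1/2 * (\<integral>\<^sup>+ x. \<phi> x * (\<Sum>i\<in>?I. ennreal (hire_mass n F \<pi> \<sigma> i x)) \<partial>count_space UNIV)"
      by (rule nn_integral_cmult) simp
    also have "(\<integral>\<^sup>+ x. \<phi> x * (\<Sum>i\<in>?I. ennreal (hire_mass n F \<pi> \<sigma> i x)) \<partial>count_space UNIV) =
        (\<Sum>i\<in>?I. \<integral>\<^sup>+ x. \<phi> x * ennreal (hire_mass n F \<pi> \<sigma> i x) \<partial>count_space UNIV)"
      unfolding sum_distrib_left by (rule nn_integral_sum) simp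
    finally show ?thesis .
  qed
  \<comment> \<open>The construction asks for a real bound on Bochner expectations, whereas
    \<open>weighted\<close> speaks of extended nonnegative integrals.\<close>
  have e: "ennreal (measure_pmf.expectation (F i) r) = (\<integral>\<^sup>+ x. ennreal (pmf (F i) x * r x) \<partial>count_space UNIV)" for i
  proof -
    have "integrable (measure_pmf (F i)) r"
      using r by (intro measure_pmf.integrable_const_bound[where B = "1/2"]) auto
    hence "ennreal (measure_pmf.expectation (F i) r) = (\<integral>\<^sup>+ x. ennreal (r x) \<partial>measure_pmf (F i))"
      using r by (subst nn_integral_eq_integral) auto
    thus ?thesis using r by (simp add: nn_integral_measure_pmf ennreal_mult)
  qed
  have "ennreal (\<Sum>i\<in>?I. measure_pmf.expectation (F i) r) =
        (\<Sum>i\<in>?I. ennreal (measure_pmf.expectation (F i) r))"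
    using r by (intro sum_ennreal[symmetric] integral_nonneg_AE) auto
  also have "\<dots> = 1/2 * (\<Sum>i\<in>?I. \<integral>\<^sup>+ x. ennreal (hire_mass n F \<pi> \<sigma> i x) \<partial>count_space UNIV)"
    using weighted[of "\<lambda>_. 1"] by (simp add: e)
  also have "\<dots> \<le> 1/2 * 1"
    by (intro mult_left_mono sum_hire_mass_le_1[OF \<pi>]) simp
  also have "\<dots> = ennreal (1/2)"
    by (simp add: ennreal_divide_numeral[symmetric] divide_ennreal_def)
  finally have "(\<Sum>i\<in>?I. measure_pmf.expectation (F i) r) \<le> 1/2"
    by (subst (asm) ennreal_le_iff) auto
  from exists_rule_with_hire_probability[OF \<pi> r this]
  obtain \<tau> where \<tau>: "\<And>i x. i \<in> ?I \<Longrightarrow> hire_mass n F \<pi> \<tau> i x = pmf (F i) x * r x" by blast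
  have "r x \<le> 1" for x using r[of x] by simp
  hence "IIF n F \<pi> \<tau>"
    unfolding IIF_def IIF_with_hire_mass using \<tau> r by (intro exI[of _ r]) auto
  moreover have "expected_value n F \<pi> \<tau> = 1/2 * expected_value n F \<pi> \<sigma>"
    unfolding expected_value_eq_hire_mass[OF \<pi>] weighted[symmetric] by (intro sum.cong) (auto simp: \<tau>)
  ultimately show ?thesis by blast
qed

section \<open>The tight two-candidate instance\<close>

definition tight_law :: "real \<Rightarrow> nat \<Rightarrow> real pmf" where
  "tight_law \<epsilon> i = (if i = 1 then return_pmf 1 else map_pmf of_bool (bernoulli_pmf \<epsilon>))"

text \<open>The whole value vector is a function of one coin, so every expectation over it becomes a
  sum of two terms.\<close>

lemma Pi_pmf_tight_law:
  "Pi_pmf {1..2} 0 (tight_law \<epsilon>) =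
     map_pmf (\<lambda>b. (\<lambda>_. 0)(1 := 1, 2 := of_bool b)) (bernoulli_pmf \<epsilon>)"
proof -
  have "{1..2} = insert (1::nat) {2}" by auto
  thus ?thesis
    by (simp add: Pi_pmf_insert Pi_pmf_singleton tight_law_def pair_return_pmf1 map_pmf_comp o_def fun_upd_def)
       (intro map_pmf_cong refl ext, simp)
qed

text \<open>The first history is always \<open>[1]\<close>, so the acceptance probability of
  candidate 1 is the single number \<open>pmf (\<sigma> [1]) True\<close>, and candidate 2 is
  reached with the complementary probability whatever the coin shows.\<close>

lemma tight_hire_mass:
  assumes "0 < \<epsilon>" "\<epsilon> < 1"
  shows "hire_mass 2 (tight_law \<epsilon>) id \<sigma> 1 1 = pmf (\<sigma> [1]) True"
    and "hire_mass 2 (tight_law \<epsilon>) id \<sigma> 2 (of_bool b) =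
           pmf (bernoulli_pmf \<epsilon>) b * ((1 - pmf (\<sigma> [1]) True) * pmf (\<sigma> [1, of_bool b]) True)"
proof -
  have upt: "[1..<Suc 2] = [1, 2]" by (simp add: upt_rec)
  define Y :: "bool \<Rightarrow> nat \<Rightarrow> real" where "Y b = (\<lambda>_. 0)(1 := 1, 2 := of_bool b)" for b
  have Y: "Y b 1 = 1" "Y b 2 = of_bool b" for b by (simp_all add: Y_def)
  have mass: "hire_mass 2 (tight_law \<epsilon>) id \<sigma> i x =
      of_bool (Y True i = x) * pmf (run_rule \<sigma> (Y True) [] [1, 2]) (Some i) * \<epsilon> +
      of_bool (Y False i = x) * pmf (run_rule \<sigma> (Y False) [] [1, 2]) (Some i) * (1 - \<epsilon>)" for i x
    unfolding hire_mass_eq_expectation Pi_pmf_tight_law Y_def[symmetric] upt list.map id_apply integral_map_pmf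
    using assms by (subst integral_bernoulli_pmf) auto
  have run: "pmf (run_rule \<sigma> X [] [1, 2]) (Some 1) = pmf (\<sigma> [X 1]) True"
    "pmf (run_rule \<sigma> X [] [1, 2]) (Some 2) =
       (1 - pmf (\<sigma> [X 1]) True) * pmf (\<sigma> [X 1, X 2]) True" for X
    unfolding pmf_run_rule_Cons by simp_all
  show "hire_mass 2 (tight_law \<epsilon>) id \<sigma> 1 1 = pmf (\<sigma> [1]) True"
    unfolding mass run Y by (simp add: algebra_simps)
  show "hire_mass 2 (tight_law \<epsilon>) id \<sigma> 2 (of_bool b) =
           pmf (bernoulli_pmf \<epsilon>) b * ((1 - pmf (\<sigma> [1]) True) * pmf (\<sigma> [1, of_bool b]) True)"
    unfolding mass run Y using assms by (cases b) simp_all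
qed

lemma tight_expected_value:
  assumes "0 < \<epsilon>" "\<epsilon> < 1"
  shows "expected_value 2 (tight_law \<epsilon>) id \<sigma> =
         ennreal (hire_mass 2 (tight_law \<epsilon>) id \<sigma> 1 1 + hire_mass 2 (tight_law \<epsilon>) id \<sigma> 2 1)"
proof -
  have supp: "hire_mass 2 (tight_law \<epsilon>) id \<sigma> i x = 0" if "i \<in> {1..2}" "x \<notin> set_pmf (tight_law \<epsilon> i)" for i x
    using hire_mass_le_pmf[OF that(1), of "tight_law \<epsilon>" id \<sigma> x] that
    by (simp add: set_pmf_iff order_antisym)
  have "(\<integral>\<^sup>+ x. ennreal x * ennreal (hire_mass 2 (tight_law \<epsilon>) id \<sigma> i x) \<partial>count_space UNIV) =
        ennreal (hire_mass 2 (tight_law \<epsilon>) id \<sigma> i 1)" if "i \<in> {1..2}" for i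
  proof -
    have "(\<integral>\<^sup>+ x. ennreal x * ennreal (hire_mass 2 (tight_law \<epsilon>) id \<sigma> i x) \<partial>count_space UNIV) =
          (\<integral>\<^sup>+ x. ennreal (hire_mass 2 (tight_law \<epsilon>) id \<sigma> i 1) * indicator {1::real} x \<partial>count_space UNIV)"
    proof (rule nn_integral_cong)
      fix x
      show "ennreal x * ennreal (hire_mass 2 (tight_law \<epsilon>) id \<sigma> i x) =
            ennreal (hire_mass 2 (tight_law \<epsilon>) id \<sigma> i 1) * indicator {1} x"
      \<comment> \<open>At 0 the value vanishes; away from 0 and 1 the mass vanishes.\<close>
      proof (cases "x = 0 \<or> x = 1")
        case False
        hence "x \<notin> set_pmf (tight_law \<epsilon> i)" by (auto simp: tight_law_def)
        thus ?thesis using supp[OF that] False by simp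
      qed auto
    qed
    thus ?thesis by simp
  qed
  thus ?thesis
    by (simp add: expected_value_eq_hire_mass permutes_id numeral_2_eq_2)
qed

text \<open>The rule \<open>\<tau>0\<close> hires candidate 1 on a fair coin and otherwise always
  hires candidate 2. Both are then hired with conditional probability 1/2 at every value, which is
  the extreme case p = 1 - p of the constraint p(1) \<le> 1 - p(1).\<close>

lemma tight_instance:
  assumes \<epsilon>: "0 < \<epsilon>" "\<epsilon> < 1"
  defines "F \<equiv> tight_law \<epsilon>"
    and "\<tau>0 \<equiv> (\<lambda>l::real list. if length l = 1 then bernoulli_pmf (1/2) else return_pmf True)"
  shows "hiring_instance 2 F id"
    and "optimal_rule 2 F id (\<lambda>_. return_pmf True)"
    and "expected_value 2 F id (\<lambda>_. return_pmf True) = 1"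
    and "optimal_IIF_rule 2 F id \<tau>0"
    and "expected_value 2 F id \<tau>0 = ennreal ((1 + \<epsilon>) / 2)"
proof -
  note mass = tight_hire_mass[OF \<epsilon>, folded F_def]
  note mass1 = mass(2)[where b = True, simplified]
  have val: "expected_value 2 F id \<sigma> = ennreal (pmf (\<sigma> [1]) True +
       \<epsilon> * ((1 - pmf (\<sigma> [1]) True) * pmf (\<sigma> [1, 1]) True))" for \<sigma>
    unfolding F_def tight_expected_value[OF \<epsilon>] using \<epsilon> mass mass1 by (simp add: F_def)
  show "hiring_instance 2 F id"
    by (auto simp: hiring_instance_def F_def tight_law_def permutes_id)
  show one: "expected_value 2 F id (\<lambda>_. return_pmf True) = 1"
    by (simp add: val)
  show "optimal_rule 2 F id (\<lambda>_. return_pmf True)"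
    unfolding optimal_rule_def one
  proof
    fix \<tau> :: stopping_rule
    let ?a = "pmf (\<tau> [1]) True" and ?b = "pmf (\<tau> [1, 1]) True"
    \<comment> \<open>Candidate 2 adds at most the probability 1 - a that candidate 1 was
      rejected.\<close>
    have "\<epsilon> * ((1 - ?a) * ?b) \<le> 1 * ((1 - ?a) * 1)"
      using \<epsilon> by (intro mult_mono mult_nonneg_nonneg) (auto simp: pmf_le_1)
    thus "expected_value 2 F id \<tau> \<le> 1" unfolding val by (simp add: ennreal_le_1)
  qed
  show half: "expected_value 2 F id \<tau>0 = ennreal ((1 + \<epsilon>) / 2)"
    by (simp add: val \<tau>0_def field_simps)
  have supp: "i = 1 \<and> x = 1 \<or> i = 2 \<and> (\<exists>b. x = of_bool b)" if "i \<in> {1..2}" "pmf (F i) x > 0" for i x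
  proof -
    have "x \<in> set_pmf (F i)" using that(2) by (simp add: set_pmf_iff)
    moreover have "i = 1 \<or> i = 2" using that(1) by auto
    moreover have "set_pmf (F 1) = {1}" "set_pmf (F 2) \<subseteq> range of_bool"
      by (auto simp: F_def tight_law_def)
    ultimately show ?thesis by blast
  qed
  have pmf2: "pmf (F 2) (of_bool b) = pmf (bernoulli_pmf \<epsilon>) b" for b
    unfolding F_def tight_law_def by (simp add: pmf_map_inj' inj_def)
  have "IIF_with 2 F id \<tau>0 (\<lambda>_. 1/2)"
    unfolding IIF_with_hire_mass
  proof (intro conjI ballI allI impI)
    fix i x assume "i \<in> {1..2::nat}" "pmf (F i) x > 0"
    from supp[OF this] show "hire_mass 2 F id \<tau>0 i x = pmf (F i) x * (1/2)"
    proof (elim disjE conjE exE)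
      assume "i = 1" "x = 1"
      moreover have "pmf (F 1) 1 = 1" by (simp add: F_def tight_law_def)
      ultimately show ?thesis by (simp only: mass(1)) (simp add: \<tau>0_def)
    next
      fix b assume "i = 2" "x = of_bool b"
      thus ?thesis by (simp only: mass(2) pmf2) (simp add: \<tau>0_def)
    qed
  qed auto
  hence "IIF 2 F id \<tau>0" by (auto simp: IIF_def)
  moreover have "expected_value 2 F id \<tau> \<le> expected_value 2 F id \<tau>0" if IIF: "IIF 2 F id \<tau>" for \<tau> :: stopping_rule
  proof -
    let ?a = "pmf (\<tau> [1]) True" and ?b = "pmf (\<tau> [1, 1]) True"
    obtain p where p: "\<And>i x. i \<in> {1..2} \<Longrightarrow> pmf (F i) x > 0 \<Longrightarrow> hire_mass 2 F id \<tau> i x = pmf (F i) x * p x"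
      using IIF unfolding IIF_def IIF_with_hire_mass by blast
    \<comment> \<open>IIF at the common value 1 forces a = (1 - a) b, where b \<le> 1 is the
      acceptance probability of candidate 2 at value 1. Hence a \<le> 1/2, and the expected value is
      a (1 + \<epsilon>).\<close>
    have "?a = p 1" using p[of 1 1] mass(1)[of \<tau>] by (simp add: F_def tight_law_def)
    moreover have "\<epsilon> * ((1 - ?a) * ?b) = \<epsilon> * p 1"
      using p[of 2 1] mass1[of \<tau>] pmf2[of True] \<epsilon> by simp
    ultimately have eq: "(1 - ?a) * ?b = ?a" using \<epsilon> by simp
    have "(1 - ?a) * ?b \<le> (1 - ?a) * 1" by (intro mult_left_mono) (auto simp: pmf_le_1)
    hence "?a \<le> 1/2" using eq by simp
    hence "?a * (1 + \<epsilon>) \<le> 1/2 * (1 + \<epsilon>)" using \<epsilon> by (intro mult_right_mono) auto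
    thus ?thesis unfolding half val[of \<tau>] eq using \<epsilon> by (intro ennreal_leI) (simp add: field_simps)
  qed
  ultimately show "optimal_IIF_rule 2 F id \<tau>0" by (auto simp: optimal_IIF_rule_def)
qed

theorem mainTheorem11:
  shows "(\<forall>n F \<pi> OPTOn OPTOnIIF.
            hiring_instance n F \<pi> \<longrightarrow> optimal_rule n F \<pi> OPTOn \<longrightarrow> optimal_IIF_rule n F \<pi> OPTOnIIF \<longrightarrow>
            expected_value n F \<pi> OPTOnIIF \<ge> 1/2 * expected_value n F \<pi> OPTOn) \<and>
         (\<forall>c::real. c > 1/2 \<longrightarrow>
            (\<exists>n F \<pi> OPTOn OPTOnIIF.
              hiring_instance n F \<pi> \<and> optimal_rule n F \<pi> OPTOn \<and> optimal_IIF_rule n F \<pi> OPTOnIIF \<and>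
              expected_value n F \<pi> OPTOnIIF < ennreal c * expected_value n F \<pi> OPTOn))"
proof (intro conjI allI impI)
  fix n F \<pi> OPTOn OPTOnIIF
  assume "hiring_instance n F \<pi>" and opt: "optimal_IIF_rule n F \<pi> OPTOnIIF"
  then obtain \<tau> where "IIF n F \<pi> \<tau>" "expected_value n F \<pi> \<tau> = 1/2 * expected_value n F \<pi> OPTOn"
    using exists_IIF_rule_half unfolding hiring_instance_def by blast
  with opt show "expected_value n F \<pi> OPTOnIIF \<ge> 1/2 * expected_value n F \<pi> OPTOn"
    unfolding optimal_IIF_rule_def by metis
next
  fix c :: real
  assume c: "c > 1/2"
  \<comment> \<open>The bound 1/2 ensures \<epsilon> < 1. The bound c - 1/2 gives (1 + \<epsilon>) /
    2 \<le> 1/2 + (c - 1/2) / 2 < c.\<close>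
  define \<epsilon> where "\<epsilon> = min (1/2) (c - 1/2)"
  have \<epsilon>: "0 < \<epsilon>" "\<epsilon> < 1" "(1 + \<epsilon>) / 2 < c" using c by (auto simp: \<epsilon>_def min_def)
  note tight = tight_instance[OF \<epsilon>(1,2)]
  have "ennreal ((1 + \<epsilon>) / 2) < ennreal c * 1" using \<epsilon> by (simp add: ennreal_less_iff)
  with tight show "\<exists>n F \<pi> OPTOn OPTOnIIF.
      hiring_instance n F \<pi> \<and> optimal_rule n F \<pi> OPTOn \<and> optimal_IIF_rule n F \<pi> OPTOnIIF \<and>
      expected_value n F \<pi> OPTOnIIF < ennreal c * expected_value n F \<pi> OPTOn"
    by metis
qed

end
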